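(* Let $n > 3$. There is no Diophantine $n$-gon, convex or concave, in which the length of some side or some diagonal is equal to $1$.
   Context: An $n$-gon is a non-degenerate simple polygon in the Euclidean plane with $n$ vertices (no vertex angle equal to $180^\circ$); it may be convex or concave (non-convex). A diagonal is a segment joining two non-adjacent vertices. An $n$-gon is called Diophantine if the lengths of all its sides and all its diagonals are natural numbers (positive integers). *)

theory Defs
  imports "HOL-Analysis.Analysis"
begin

text \<open>
  A polygon with \<open>n\<close> vertices is given by its vertices \<open>v 0, \<dots>, v (n - 1)\<close> in cyclic order;
  the values \<open>v i\<close> for \<open>i \<ge> n\<close> are irrelevant.
\<close>

definition cyc_next :: "nat \<Rightarrow> nat \<Rightarrow> nat" where
  "cyc_next n i = Suc i mod n"

definition adjacent :: "nat \<Rightarrow> nat \<Rightarrow> nat \<Rightarrow> bool" where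
  "adjacent n i j \<longleftrightarrow> j = cyc_next n i \<or> i = cyc_next n j"

definition side :: "nat \<Rightarrow> (nat \<Rightarrow> real ^ 2) \<Rightarrow> nat \<Rightarrow> (real ^ 2) set" where
  "side n v i = closed_segment (v i) (v (cyc_next n i))"

definition simple_polygon :: "nat \<Rightarrow> (nat \<Rightarrow> real ^ 2) \<Rightarrow> bool" where
  "simple_polygon n v \<longleftrightarrow>
     n \<ge> 3 \<and> inj_on v {..<n} \<and>
     (\<forall>i<n. side n v i \<inter> side n v (cyc_next n i) = {v (cyc_next n i)}) \<and>
     (\<forall>i<n. \<forall>j<n. i \<noteq> j \<and> \<not> adjacent n i j \<longrightarrow> side n v i \<inter> side n v j = {})"

text \<open>
  The unsigned angle at \<open>b\<close> between the rays towards \<open>a\<close> and \<open>c\<close>, with values in \<open>[0, pi]\<close>.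
  The interior angle of a polygon at \<open>b\<close> is this angle or \<open>2 * pi\<close> minus it, so one of them
  is equal to \<open>pi\<close> iff the other is.
\<close>

definition angle_at :: "real ^ 2 \<Rightarrow> real ^ 2 \<Rightarrow> real ^ 2 \<Rightarrow> real" where
  "angle_at a b c = arccos (((a - b) \<bullet> (c - b)) / (norm (a - b) * norm (c - b)))"

text \<open>Convexity is not required: both convex and concave polygons are covered.\<close>

definition ngon :: "nat \<Rightarrow> (nat \<Rightarrow> real ^ 2) \<Rightarrow> bool" where
  "ngon n v \<longleftrightarrow>
     simple_polygon n v \<and>
     (\<forall>i<n. angle_at (v i) (v (cyc_next n i)) (v (cyc_next n (cyc_next n i))) \<noteq> pi)"

definition side_lengths :: "nat \<Rightarrow> (nat \<Rightarrow> real ^ 2) \<Rightarrow> real set" where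
  "side_lengths n v = {dist (v i) (v (cyc_next n i)) | i. i < n}"

definition diagonal_lengths :: "nat \<Rightarrow> (nat \<Rightarrow> real ^ 2) \<Rightarrow> real set" where
  "diagonal_lengths n v =
     {dist (v i) (v j) | i j. i < n \<and> j < n \<and> i \<noteq> j \<and> \<not> adjacent n i j}"

definition diophantine_ngon :: "nat \<Rightarrow> (nat \<Rightarrow> real ^ 2) \<Rightarrow> bool" where
  "diophantine_ngon n v \<longleftrightarrow>
     ngon n v \<and>
     (\<forall>l \<in> side_lengths n v \<union> diagonal_lengths n v. \<exists>k::nat. k > 0 \<and> l = real k)"

end

theory Submission
  imports Defs
begin

text \<open>
  All distances between vertices are integers. Suppose that the vertices \<open>P\<close> and \<open>Q\<close> are at distance 1. For every other vertex \<open>R\<close>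
  the integers \<open>RP\<close> and \<open>RQ\<close> differ by at most 1. If they differ by exactly 1, the triangle
  inequality is an equality and \<open>R\<close> lies on the line \<open>PQ\<close>; if they are equal, \<open>R\<close> lies on the
  perpendicular bisector of \<open>PQ\<close> (lemma \<open>equidistant_or_collinear\<close>).

  The bisector carries at most one vertex (lemma \<open>integer_distances_on_bisector\<close>): if \<open>R\<close>
  and \<open>S\<close> both lie on it, comparing \<open>RP\<^sup>2 - SP\<^sup>2\<close> with the integer \<open>RS\<close> makes the
  height of \<open>R\<close> above \<open>PQ\<close> rational, although four times its square is \<open>4 RP\<^sup>2 - 1\<close>, which
  is no square modulo 4.

  So all vertices but at most one lie on the line \<open>PQ\<close>. Such integral point sets exist, for
  example the points 0, 1, 4 of a line together with the point at distance 2 from 0 and 1. But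
  from \<open>n > 3\<close> there are three consecutive vertices on the line, which is
  excluded by the shape of a polygon: either two successive sides overlap, or the middle
  vertex has angle \<open>pi\<close> (lemma \<open>ngon_consecutive_not_collinear\<close>).
\<close>

section \<open>Integral distances to two points at distance one\<close>

lemma equidistant_or_collinear:
  fixes P Q R :: "'a::euclidean_space"
  assumes "dist P Q = 1" "dist R P = real a" "dist R Q = real b"
  shows "a = b \<or> collinear {P, Q, R}"
proof -
  have "\<bar>real a - real b\<bar> \<le> 1"
    using assms dist_triangle[of R P Q] dist_triangle[of R Q P] by (simp add: dist_commute)
  then consider "a = b" | "real a = real b + 1" | "real b = real a + 1"
    by linarith
  then show ?thesis
  proof cases
    case 2
    then have "between (R, P) Q"
      using assms by (simp add: between dist_commute)
    then show ?thesis
      using collinear_between_cases[of P Q R] by auto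
  next
    case 3
    then have "between (Q, R) P"
      using assms by (simp add: between dist_commute)
    then show ?thesis
      using collinear_between_cases[of P Q R] by (auto simp: between_commute)
  qed simp
qed

text \<open>
  Dividing by \<open>d\<^sup>2\<close> would make \<open>4 a\<^sup>2 - 1\<close> a perfect square, but it is 3 modulo 4.
\<close>

lemma square_ne_square_times_4_square_minus_1:
  fixes N d a :: int
  assumes "d \<noteq> 0"
  shows "N\<^sup>2 \<noteq> d\<^sup>2 * (4 * a\<^sup>2 - 1)"
proof
  assume eq: "N\<^sup>2 = d\<^sup>2 * (4 * a\<^sup>2 - 1)"
  then have "d\<^sup>2 dvd N\<^sup>2" by simp
  then obtain k where "N = d * k" by auto
  then have k: "k\<^sup>2 = 4 * a\<^sup>2 - 1"
    using eq assms by (simp add: power_mult_distrib)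
  show False
  proof (cases "even k")
    case True
    then obtain m where "k = 2 * m" by blast
    with k have "4 * m\<^sup>2 = 4 * a\<^sup>2 - 1" by (simp add: power_mult_distrib)
    then show False by presburger
  next
    case False
    then obtain m where "k = 2 * m + 1" using oddE by blast
    with k have "4 * (m\<^sup>2 + m) + 2 = 4 * a\<^sup>2"
      by (simp add: power2_eq_square algebra_simps)
    then show False by presburger
  qed
qed

text \<open>
  The place where the dimension matters: vectors orthogonal to a common nonzero vector are
  parallel in the plane, so the Cauchy-Schwarz inequality is an equality.
\<close>

lemma inner_square_eq_of_common_normal:
  fixes p r u :: "real ^ 2"
  assumes "u \<noteq> 0" "p \<bullet> u = 0" "r \<bullet> u = 0"
  shows "(p \<bullet> r)\<^sup>2 = (p \<bullet> p) * (r \<bullet> r)"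
proof -
  have p: "p $ 1 * u $ 1 + p $ 2 * u $ 2 = 0" and r: "r $ 1 * u $ 1 + r $ 2 * u $ 2 = 0"
    using assms by (simp_all add: inner_vec_def sum_2)
  define D where "D = p $ 1 * r $ 2 - p $ 2 * r $ 1"
  have "D * u $ 1 = 0" "D * u $ 2 = 0"
    using p r unfolding D_def by algebra+
  moreover have "u $ 1 \<noteq> 0 \<or> u $ 2 \<noteq> 0"
    using \<open>u \<noteq> 0\<close> by (auto simp: vec_eq_iff forall_2)
  ultimately have "D = 0" by auto
  moreover have "(p \<bullet> p) * (r \<bullet> r) = (p \<bullet> r)\<^sup>2 + D\<^sup>2"
    by (simp add: D_def inner_vec_def sum_2 power2_eq_square algebra_simps)
  ultimately show ?thesis by simp
qed

text \<open>
  With \<open>M\<close> the midpoint of \<open>PQ\<close>, the vectors \<open>R - M\<close> and \<open>R - S\<close> are parallel. Hence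
  \<open>N = 2 (R - M) \<bullet> (R - S)\<close>, which the law of cosines shows to be the integer
  \<open>a\<^sup>2 + d\<^sup>2 - b\<^sup>2\<close>, satisfies \<open>N\<^sup>2 = 4 RM\<^sup>2 RS\<^sup>2 = (4 a\<^sup>2 - 1) d\<^sup>2\<close>.
\<close>

lemma integer_distances_on_bisector:
  fixes P Q R S :: "real ^ 2"
  assumes PQ: "dist P Q = 1"
    and R: "dist R P = real a" "dist R Q = real a"
    and S: "dist S P = real b" "dist S Q = real b"
    and RS: "dist R S = real d"
  shows "R = S"
proof (rule ccontr)
  assume "R \<noteq> S"
  then have "d \<noteq> 0" using RS by (metis dist_eq_0_iff of_nat_0)
  have sq: "(x - y) \<bullet> (x - y) = (dist x y)\<^sup>2" for x y :: "real ^ 2"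
    by (simp add: dist_norm power2_norm_eq_inner)
  define u p q where "u = (1/2) *\<^sub>R (Q - P)"
    and "p = R - (1/2) *\<^sub>R (P + Q)" and "q = S - (1/2) *\<^sub>R (P + Q)"
  have diffs: "R - P = p + u" "R - Q = p - u" "S - P = q + u" "S - Q = q - u"
      "Q - P = 2 *\<^sub>R u" "R - S = p - q"
    unfolding p_def q_def u_def by (simp_all add: vec_eq_iff field_simps)
  have eqs: "(p + u) \<bullet> (p + u) = (real a)\<^sup>2" "(p - u) \<bullet> (p - u) = (real a)\<^sup>2"
      "(q + u) \<bullet> (q + u) = (real b)\<^sup>2" "(q - u) \<bullet> (q - u) = (real b)\<^sup>2"
      "(2 *\<^sub>R u) \<bullet> (2 *\<^sub>R u) = 1" "(p - q) \<bullet> (p - q) = (real d)\<^sup>2"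
    unfolding diffs[symmetric] sq R S RS using PQ by (simp_all add: dist_commute)
  have pu: "p \<bullet> u = 0" and qu: "q \<bullet> u = 0" and uu: "4 * (u \<bullet> u) = 1"
    using eqs by (simp_all add: inner_simps inner_commute)
  have pp: "4 * (p \<bullet> p) = 4 * (real a)\<^sup>2 - 1"
    using eqs(1) pu uu by (simp add: inner_simps inner_commute)
  have qq: "4 * (q \<bullet> q) = 4 * (real b)\<^sup>2 - 1"
    using eqs(3) qu uu by (simp add: inner_simps inner_commute)
  have N: "2 * (p \<bullet> (p - q)) = (real a)\<^sup>2 + (real d)\<^sup>2 - (real b)\<^sup>2"
    using eqs(6) pp qq by (simp add: inner_simps inner_commute)
  have "u \<noteq> 0" using uu by auto
  then have "(p \<bullet> (p - q))\<^sup>2 = (p \<bullet> p) * ((p - q) \<bullet> (p - q))"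
    using pu qu by (intro inner_square_eq_of_common_normal[of u]) (simp_all add: inner_diff_left)
  then have "(2 * (p \<bullet> (p - q)))\<^sup>2 = (4 * (p \<bullet> p)) * ((p - q) \<bullet> (p - q))"
    by (simp add: power_mult_distrib)
  then have "((real a)\<^sup>2 + (real d)\<^sup>2 - (real b)\<^sup>2)\<^sup>2 = (real d)\<^sup>2 * (4 * (real a)\<^sup>2 - 1)"
    unfolding N pp eqs(6) by simp
  then have "real_of_int (((int a)\<^sup>2 + (int d)\<^sup>2 - (int b)\<^sup>2)\<^sup>2)
      = real_of_int ((int d)\<^sup>2 * (4 * (int a)\<^sup>2 - 1))"
    by simp
  then have "((int a)\<^sup>2 + (int d)\<^sup>2 - (int b)\<^sup>2)\<^sup>2 = (int d)\<^sup>2 * (4 * (int a)\<^sup>2 - 1)"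
    by (simp only: of_int_eq_iff)
  then show False
    using square_ne_square_times_4_square_minus_1[of "int d"] \<open>d \<noteq> 0\<close> by simp
qed

section \<open>Consecutive vertices of a polygon\<close>

lemma angle_at_between:
  assumes "b \<in> closed_segment a c" "a \<noteq> b" "c \<noteq> b"
  shows "angle_at a b c = pi"
proof -
  obtain t where t: "0 \<le> t" "t \<le> 1" and b: "b = (1 - t) *\<^sub>R a + t *\<^sub>R c"
    using assms(1) by (auto simp: in_segment)
  have ab: "a - b = t *\<^sub>R (a - c)" and cb: "c - b = (t - 1) *\<^sub>R (a - c)"
    unfolding b by (simp_all add: algebra_simps)
  have nz: "t \<noteq> 0" "t \<noteq> 1" "a \<noteq> c"
    using assms(2,3) ab cb by auto
  have "(t *\<^sub>R x) \<bullet> ((t - 1) *\<^sub>R x) = - (norm (t *\<^sub>R x) * norm ((t - 1) *\<^sub>R x))"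
    for x :: "real ^ 2"
    using t by (simp add: dot_square_norm power2_eq_square abs_of_nonpos)
      (simp add: algebra_simps)
  then have "(a - b) \<bullet> (c - b) = - (norm (a - b) * norm (c - b))"
    unfolding ab cb .
  then show ?thesis
    using assms(2,3) by (simp add: angle_at_def)
qed

lemma cyc_next_iterates_distinct:
  assumes "n > 3" "i < n"
  shows "cyc_next n i \<noteq> i" "cyc_next n (cyc_next n i) \<noteq> i"
    "cyc_next n (cyc_next n (cyc_next n i)) \<noteq> i"
  using assms by (auto simp: cyc_next_def mod_Suc split: if_splits)

text \<open>
  One of three collinear points lies between the others. If it is an outer one, it is common
  to the two sides, which only share the middle vertex; if it is the middle one, the angle
  there is \<open>pi\<close>.
\<close>

lemma ngon_consecutive_not_collinear:
  assumes "ngon n v" "n > 3" "i < n"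
  shows "\<not> collinear {v i, v (cyc_next n i), v (cyc_next n (cyc_next n i))}"
proof
  define j k where "j = cyc_next n i" and "k = cyc_next n j"
  assume "collinear {v i, v (cyc_next n i), v (cyc_next n (cyc_next n i))}"
  then have col: "collinear {v i, v j, v k}" by (simp add: j_def k_def)
  have lt: "j < n" "k < n"
    using assms by (simp_all add: j_def k_def cyc_next_def)
  have ne: "i \<noteq> j" "j \<noteq> k"
    using cyc_next_iterates_distinct(1)[OF \<open>n > 3\<close>] assms(3) lt unfolding j_def k_def by metis+
  have "inj_on v {..<n}"
    and sides: "closed_segment (v i) (v j) \<inter> closed_segment (v j) (v k) = {v j}"
    and angle: "angle_at (v i) (v j) (v k) \<noteq> pi"
    using assms by (auto simp: ngon_def simple_polygon_def side_def j_def k_def)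
  then have vne: "v i \<noteq> v j" "v k \<noteq> v j"
    using lt ne assms(3) by (auto simp: inj_on_eq_iff)
  consider "v i \<in> closed_segment (v j) (v k)" | "v j \<in> closed_segment (v k) (v i)"
    | "v k \<in> closed_segment (v i) (v j)"
    using col by (auto simp: collinear_between_cases between_mem_segment)
  then show False
  proof cases
    case 1
    then have "v i \<in> closed_segment (v i) (v j) \<inter> closed_segment (v j) (v k)" by simp
    then show False using sides vne by auto
  next
    case 2
    then show False
      using angle_at_between[of "v j" "v i" "v k"] vne angle by (simp add: closed_segment_commute)
  next
    case 3
    then have "v k \<in> closed_segment (v i) (v j) \<inter> closed_segment (v j) (v k)" by simp
    then show False using sides vne by auto
  qed
qed

lemma diophantine_ngon_dist:
  assumes "diophantine_ngon n v" "i < n" "j < n"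
  shows "\<exists>k. dist (v i) (v j) = real k"
proof (cases "i = j")
  case True
  then show ?thesis by (auto intro: exI[of _ 0])
next
  case False
  have "dist (v i) (v j) \<in> side_lengths n v \<union> diagonal_lengths n v"
  proof (cases "adjacent n i j")
    case True
    then show ?thesis
      using assms(2,3) by (auto simp: adjacent_def side_lengths_def dist_commute)
  next
    case nonadjacent: False
    then show ?thesis
      using assms(2,3) False by (auto simp: diagonal_lengths_def)
  qed
  then show ?thesis
    using assms(1) unfolding diophantine_ngon_def by blast
qed

section \<open>Diophantine polygons have no distance one\<close>

theorem mainTheorem1:
  fixes n :: nat
  assumes "n > 3"
  shows "\<not> (\<exists>v :: nat \<Rightarrow> real ^ 2. diophantine_ngon n v \<and>
               (1 \<in> side_lengths n v \<or> 1 \<in> diagonal_lengths n v))"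
proof
  assume "\<exists>v :: nat \<Rightarrow> real ^ 2. diophantine_ngon n v \<and>
    (1 \<in> side_lengths n v \<or> 1 \<in> diagonal_lengths n v)"
  then obtain v :: "nat \<Rightarrow> real ^ 2" where v: "diophantine_ngon n v"
    and one: "1 \<in> side_lengths n v \<or> 1 \<in> diagonal_lengths n v"
    by blast
  have next_lt: "cyc_next n i < n" for i
    using assms by (simp add: cyc_next_def)
  have "\<exists>i<n. \<exists>j<n. dist (v i) (v j) = 1"
    using one next_lt unfolding side_lengths_def diagonal_lengths_def by fastforce
  then obtain a b where ab: "a < n" "b < n" "dist (v a) (v b) = 1"
    by blast
  define on_line where "on_line i \<longleftrightarrow> collinear {v a, v b, v i}" for i
  have equidistant: "\<exists>k. dist (v i) (v a) = real k \<and> dist (v i) (v b) = real k"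
    if "i < n" "\<not> on_line i" for i
    using diophantine_ngon_dist[OF v \<open>i < n\<close>] ab equidistant_or_collinear[OF ab(3)] that
    unfolding on_line_def by metis
  have inj: "inj_on v {..<n}"
    using v by (simp add: diophantine_ngon_def ngon_def simple_polygon_def)
  have off_unique: "i = j" if "i < n" "j < n" "\<not> on_line i" "\<not> on_line j" for i j
  proof -
    have "v i = v j"
      using equidistant[of i] equidistant[of j] diophantine_ngon_dist[OF v, of i j] that
        integer_distances_on_bisector[OF ab(3)] by metis
    then show ?thesis
      using inj that by (simp add: inj_on_eq_iff)
  qed
  obtain r where r: "r < n" "\<And>i. i < n \<Longrightarrow> i \<noteq> r \<Longrightarrow> on_line i"
  proof (cases "\<forall>i<n. on_line i")
    case True
    then show ?thesis using that[of 0] assms by simp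
  next
    case False
    then show ?thesis using that off_unique by blast
  qed
  \<comment> \<open>The three successors of \<open>r\<close> avoid \<open>r\<close> since the cycle has length at least four.\<close>
  define i where "i = cyc_next n r"
  have "on_line i" "on_line (cyc_next n i)" "on_line (cyc_next n (cyc_next n i))"
    using r next_lt cyc_next_iterates_distinct[OF assms r(1)] by (auto simp: i_def)
  moreover have "v a \<noteq> v b" using ab(3) by auto
  ultimately have "collinear (insert (v a) (insert (v b)
      {v i, v (cyc_next n i), v (cyc_next n (cyc_next n i))}))"
    unfolding on_line_def by (subst collinear_triples) blast+
  then have "collinear {v i, v (cyc_next n i), v (cyc_next n (cyc_next n i))}"
    by (rule collinear_subset) auto
  then show False
    using ngon_consecutive_not_collinear[of n v i] v assms next_lt
    by (simp add: diophantine_ngon_def i_def)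
qed

end
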